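(* There exist absolute constants $C>0$ and $\varepsilon_0\in(0,1)$ such that for every integer $n\ge 2$ and every $\varepsilon\in(0,\varepsilon_0)$ there are a map $E$ (the data structure) assigning to each set $P$ of $n$ points of the grid $\{0,1,\dots,n-1\}^2$ a bit string $E(P)$ of length at most $$C\cdot \frac{1}{\varepsilon}\log\frac{1}{\varepsilon}\,\log\log\frac{1}{\varepsilon}\,\log n,$$ and a query map $Q$ assigning a real number $Q(E(P),R)$ to every such bit string and every axis-parallel rectangle $R\subseteq\mathbb{R}^2$, such that for every such $P$ and every axis-parallel rectangle $R$, $$\bigl|\,Q(E(P),R)-|P\cap R|\,\bigr|\le \varepsilon n .$$
   Context: An orthogonal range (orthogonal rectangle) is an axis-parallel rectangle in the plane. The data structure may store arbitrary information; only its size in bits is measured, and queries must be answered using only the stored bits. Logarithms are base 2. *)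

theory Defs
  imports Complex_Main
begin

definition grid :: "nat \<Rightarrow> (real \<times> real) set" where
  "grid n = (real ` {0..<n}) \<times> (real ` {0..<n})"

(* Rectangles are closed; degenerate ones (segments and points) are allowed. *)
definition axis_parallel_rectangle :: "(real \<times> real) set \<Rightarrow> bool" where
  "axis_parallel_rectangle R \<longleftrightarrow>
     (\<exists>a b c d. a \<le> b \<and> c \<le> d \<and> R = {a..b} \<times> {c..d})"

end

theory Submission
  imports Defs
begin

text \<open>
  Inclusion-exclusion reduces rectangles to dominance queries. Build a binary tree on the
  x-medians with about \<open>log (1/\<epsilon>)\<close> levels; a dominance query is the sum of at most one count
  \<open>y < b\<close> per level, so these counts may be wrong by \<open>G = \<Theta>(\<epsilon>n / log (1/\<epsilon>))\<close>. Every node with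
  \<open>N\<close> points carries a set of at most \<open>2N/G\<close> cuts in y-direction with at most \<open>G\<close> of its points
  between consecutive cuts. The cuts of a child can be chosen among those of its parent without
  widening the gaps: a gap of the parent contains at most \<open>G\<close> points of the child as well, so one
  only has to merge gaps greedily while they hold at most \<open>G\<close> points. Hence a cut costs one bit
  per level instead of a coordinate. Likewise the counts at the cuts, rounded down to multiples of
  \<open>G\<close>, increase by at most one unit from cut to cut and also cost one bit each. Only the cuts at
  the root and the medians need \<open>O(log n)\<close> bits each. Instead of concrete bit strings we count
  the possible sketches. If \<open>\<epsilon>n\<close> is below the order of \<open>log (1/\<epsilon>)\<close>, the points are stored exactly.
\<close>

subsection \<open>Nets of cuts\<close>

definition dom_count :: "(nat \<times> nat) set \<Rightarrow> nat \<Rightarrow> nat \<Rightarrow> nat" where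
  "dom_count S a b = card {p \<in> S. fst p < a \<and> snd p < b}"

definition band :: "(nat \<times> nat) set \<Rightarrow> nat \<Rightarrow> nat \<Rightarrow> nat" where
  "band S u v = card {p \<in> S. u \<le> snd p \<and> snd p < v}"

text \<open>A cut \<open>y \<in> Y\<close> separates the points of height below \<open>y\<close> from those of height at least \<open>y\<close>.\<close>

definition is_net :: "nat \<Rightarrow> nat set \<Rightarrow> (nat \<times> nat) set \<Rightarrow> bool" where
  "is_net G Y S \<longleftrightarrow> (\<forall>u v. Y \<inter> {u<..<v} = {} \<longrightarrow> band S u v \<le> G)"

lemma band_mono:
  assumes "finite S" "S' \<subseteq> S" "u' \<le> u" "v \<le> v'"
  shows "band S' u v \<le> band S u' v'"
  unfolding band_def using assms by (intro card_mono) auto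

lemma is_net_mono:
  assumes "is_net G Y S" "finite S" "S' \<subseteq> S" "Y \<subseteq> Y'"
  shows "is_net G Y' S'"
  unfolding is_net_def
proof (intro allI impI)
  fix u v assume "Y' \<inter> {u<..<v} = {}"
  then have "Y \<inter> {u<..<v} = {}" using assms(4) by blast
  then have "band S u v \<le> G" using assms(1) by (auto simp: is_net_def)
  then show "band S' u v \<le> G" using band_mono[OF assms(2,3) order_refl order_refl] le_trans by blast
qed

text \<open>Two consecutive integers have no cut strictly between them, so even the set of all cuts
  leaves single heights undivided. Distinct heights make each of them hold at most one
  point.\<close>

lemma is_net_UNIV:
  assumes "inj_on snd S" "finite S" "G \<ge> 1"
  shows "is_net G UNIV S"
  unfolding is_net_def
proof (intro allI impI)
  fix u v :: nat assume "UNIV \<inter> {u<..<v} = {}"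
  then have "Suc u \<notin> {u<..<v}" by blast
  then have v: "v \<le> Suc u" by auto
  have "band S u v = card (snd ` {p \<in> S. u \<le> snd p \<and> snd p < v})"
    unfolding band_def by (intro card_image[symmetric] inj_on_subset[OF assms(1)]) auto
  also have "\<dots> \<le> card {u}" using v by (intro card_mono) auto
  finally show "band S u v \<le> G" using assms(3) by simp
qed

text \<open>Greedy choice: let \<open>t\<close> be the first height at which the band from
  \<open>u0\<close> exceeds \<open>G\<close>, keep the last cut \<open>y\<close> before
  \<open>t\<close> and the first cut \<open>z\<close> from \<open>t\<close> on, and restart at
  \<open>z\<close>. These two cuts are charged to the at least \<open>G + 1\<close> points between
  \<open>u0\<close> and \<open>t\<close>; the charged bands are disjoint.\<close>

lemma thin_net_above:
  assumes "finite S" "is_net G Y S"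
  shows "\<exists>Y' \<subseteq> Y \<inter> {u0<..}. finite Y' \<and>
           (\<forall>u v. u0 \<le> u \<longrightarrow> Y' \<inter> {u<..<v} = {} \<longrightarrow> band S u v \<le> G) \<and>
           (G + 1) * card Y' \<le> 2 * card {p \<in> S. u0 \<le> snd p}"
proof (induction "card {p \<in> S. u0 \<le> snd p}" arbitrary: u0 rule: less_induct)
  case less
  have net: "band S u v \<le> G" if "Y \<inter> {u<..<v} = {}" for u v
    using assms(2) that by (auto simp: is_net_def)
  have upper: "band S u v \<le> card {p \<in> S. u0 \<le> snd p}" if "u0 \<le> u" for u v
    unfolding band_def using assms(1) that by (intro card_mono) auto
  show ?case
  proof (cases "\<exists>t. band S u0 t > G")
    case False
    have "band S u v \<le> G" if "u0 \<le> u" for u v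
      using False band_mono[OF assms(1) order_refl that order_refl, of v] by (meson le_trans not_le)
    then show ?thesis by (intro exI[of _ "{}"]) auto
  next
    case True
    define t where "t = (LEAST t. band S u0 t > G)"
    have t: "band S u0 t > G" unfolding t_def using True by (rule LeastI_ex)
    have before_t: "band S u0 v \<le> G" if "v < t" for v
      using not_less_Least[of v "\<lambda>t. band S u0 t > G"] that unfolding t_def by simp
    \<comment> \<open>A band with more than \<open>G\<close> points must be divided by some cut of
      the given net.\<close>
    have "Y \<inter> {u0<..<t} \<noteq> {}" using net[of u0 t] t by auto
    define y where "y = Max (Y \<inter> {u0<..<t})"
    have y: "y \<in> Y \<inter> {u0<..<t}" unfolding y_def
      using \<open>Y \<inter> {u0<..<t} \<noteq> {}\<close> by (intro Max_in) auto
    have y_max: "z \<le> y" if "z \<in> Y" "u0 < z" "z < t" for z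
      unfolding y_def using that by (intro Max_ge) auto
    have left: "band S u v \<le> G" if "u0 \<le> u" "v \<le> y" for u v
      using before_t[of y] y band_mono[OF assms(1) order_refl that] by simp
    show ?thesis
    proof (cases "\<exists>z \<in> Y. t \<le> z")
      case False
      have "band S u v \<le> G" if u: "u0 \<le> u" and c: "{y} \<inter> {u<..<v} = {}" for u v
      proof (cases "v \<le> y")
        case True then show ?thesis using left u by blast
      next
        case F: False
        then have "y \<le> u" using c by auto
        have "Y \<inter> {u<..<v} = {}"
        proof (rule ccontr)
          assume "Y \<inter> {u<..<v} \<noteq> {}"
          then obtain z where "z \<in> Y" "u < z" by auto
          then show False using y_max[of z] False \<open>y \<le> u\<close> y by (cases "z < t") auto
        qed
        then show ?thesis by (rule net)
      qed
      moreover have "(G + 1) * card {y} \<le> 2 * card {p \<in> S. u0 \<le> snd p}"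
        using upper[of u0 t] t by simp
      ultimately show ?thesis using y by (intro exI[of _ "{y}"]) auto
    next
      case True
      define z where "z = (LEAST z. z \<in> Y \<and> t \<le> z)"
      have z: "z \<in> Y" "t \<le> z" using LeastI_ex[of "\<lambda>z. z \<in> Y \<and> t \<le> z"] True unfolding z_def by auto
      have z_min: "z \<le> w" if "w \<in> Y" "t \<le> w" for w
        unfolding z_def using that by (intro Least_le) auto
      \<comment> \<open>Since \<open>t \<le> z\<close>, the charged band is disjoint from the points
        left for the restart; this also makes the induction measure drop.\<close>
      have split: "band S u0 t + card {p \<in> S. z \<le> snd p} \<le> card {p \<in> S. u0 \<le> snd p}"
      proof -
        have "band S u0 t + card {p \<in> S. z \<le> snd p} =
              card ({p \<in> S. u0 \<le> snd p \<and> snd p < t} \<union> {p \<in> S. z \<le> snd p})"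
          unfolding band_def using assms(1) z by (intro card_Un_disjoint[symmetric]) auto
        also have "\<dots> \<le> card {p \<in> S. u0 \<le> snd p}"
          using assms(1) y z by (intro card_mono) auto
        finally show ?thesis .
      qed
      obtain Y' where Y': "Y' \<subseteq> Y \<inter> {z<..}" "finite Y'"
        "\<And>u v. z \<le> u \<Longrightarrow> Y' \<inter> {u<..<v} = {} \<Longrightarrow> band S u v \<le> G"
        "(G + 1) * card Y' \<le> 2 * card {p \<in> S. z \<le> snd p}"
        using less[of z] split t by auto
      let ?Y = "insert y (insert z Y')"
      have "band S u v \<le> G" if u: "u0 \<le> u" and c: "?Y \<inter> {u<..<v} = {}" for u v
      proof -
        \<comment> \<open>Below \<open>y\<close> the choice of \<open>t\<close> bounds the band,
          between \<open>y\<close> and \<open>z\<close> the old net does, because \<open>Y\<close>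
          has no cut there, and above \<open>z\<close> the induction hypothesis does.\<close>
        consider "v \<le> y" | "y \<le> u" "v \<le> z" | "z \<le> u" using c by fastforce
        then show ?thesis
        proof cases
          case 1 then show ?thesis using left u by blast
        next
          case 2
          have "Y \<inter> {u<..<v} = {}"
          proof (rule ccontr)
            assume "Y \<inter> {u<..<v} \<noteq> {}"
            then obtain w where "w \<in> Y" "u < w" "w < v" by auto
            then show False using y_max[of w] z_min[of w] 2 y by (cases "w < t") auto
          qed
          then show ?thesis by (rule net)
        next
          case 3 then show ?thesis using Y'(3) c by blast
        qed
      qed
      moreover have "(G + 1) * card ?Y \<le> 2 * card {p \<in> S. u0 \<le> snd p}"
      proof -
        have "card ?Y \<le> 2 + card Y'"
          using Y'(2) by (simp add: card_insert_if)
        then have "(G + 1) * card ?Y \<le> (G + 1) * (2 + card Y')" by (rule mult_le_mono2)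
        also have "\<dots> = 2 * (G + 1) + (G + 1) * card Y'" by (simp add: algebra_simps)
        also have "\<dots> \<le> 2 * band S u0 t + 2 * card {p \<in> S. z \<le> snd p}"
          using t Y'(4) by (intro add_mono) auto
        finally show ?thesis using split by linarith
      qed
      ultimately show ?thesis using y z Y'(1,2)
        by (intro exI[of _ ?Y]) auto
    qed
  qed
qed

text \<open>Applied to all points at the root and to each child with the cuts of its parent.
  Choosing inside \<open>Y\<close> is what lets a child's net be stored as a subset of its
  parent's.\<close>

lemma thin_net:
  assumes "finite S" "is_net G Y S"
  obtains Y' where "Y' \<subseteq> Y" "finite Y'" "is_net G Y' S" "G * card Y' \<le> 2 * card S"
proof -
  obtain Y' where Y': "Y' \<subseteq> Y \<inter> {0<..}" "finite Y'"
      "\<forall>u v. 0 \<le> u \<longrightarrow> Y' \<inter> {u<..<v} = {} \<longrightarrow> band S u v \<le> G"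
      "(G + 1) * card Y' \<le> 2 * card {p \<in> S. 0 \<le> snd p}"
    using thin_net_above[OF assms, of 0] by blast
  have "is_net G Y' S" using Y'(3) by (auto simp: is_net_def)
  moreover have "G * card Y' \<le> 2 * card S" using Y'(4) by simp
  ultimately show ?thesis using that Y' by blast
qed

section \<open>Rounded counts at the cuts\<close>

text \<open>The set of jumps determines a staircase with unit steps, so a function of this kind can
  be stored as a set.\<close>

lemma unit_steps_count:
  fixes q :: "nat \<Rightarrow> nat"
  assumes "q 0 = 0" "\<And>b. q (Suc b) = q b \<or> q (Suc b) = Suc (q b)"
  shows "card ({Suc b |b. q (Suc b) = Suc (q b)} \<inter> {..b}) = q b"
proof (induction b)
  case 0
  have "{Suc b |b. q (Suc b) = Suc (q b)} \<inter> {..0} = {}" by auto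
  then show ?case using assms(1) by simp
next
  case (Suc b)
  let ?Z = "{Suc b |b. q (Suc b) = Suc (q b)}"
  show ?case
  proof (cases "q (Suc b) = Suc (q b)")
    case True
    then have "?Z \<inter> {..Suc b} = insert (Suc b) (?Z \<inter> {..b})" by (auto simp: le_Suc_eq)
    then show ?thesis using Suc True by simp
  next
    case False
    then have "Suc b \<notin> ?Z" by auto
    then have "?Z \<inter> {..Suc b} = ?Z \<inter> {..b}" by (simp add: atMost_Suc)
    then show ?thesis using Suc False assms(2)[of b] by simp
  qed
qed

text \<open>Round the query height down to a cut and the count there down to a multiple of
  \<open>G\<close>. The quotient changes only at cuts and by at most one, as a gap holds at most
  \<open>G\<close> points; its jumps form \<open>Z\<close>. Each of the two roundings loses at most
  \<open>G\<close>.\<close>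

lemma net_rank_estimate:
  assumes "finite S" "is_net G Y S" "G \<ge> 1"
  obtains Z where "Z \<subseteq> Y"
    "\<And>b. G * card (Z \<inter> {..b}) \<le> band S 0 b \<and> band S 0 b \<le> G * card (Z \<inter> {..b}) + 2 * G"
proof -
  \<comment> \<open>The last cut up to \<open>b\<close>; the default 0 fits because no point lies
    below height 0.\<close>
  define l where "l b = Max (insert 0 (Y \<inter> {..b}))" for b
  define q where "q b = band S 0 (l b) div G" for b
  have l_le: "l b \<le> b" for b unfolding l_def by (subst Max_le_iff) auto
  have l_0: "l 0 = 0" using l_le[of 0] by simp
  have l_Suc: "l (Suc b) = (if Suc b \<in> Y then Suc b else l b)" for b
  proof (cases "Suc b \<in> Y")
    case True
    then show ?thesis using l_le[of "Suc b"] unfolding l_def by (intro antisym) (auto intro!: Max_ge)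
  next
    case False
    then have "Y \<inter> {..Suc b} = Y \<inter> {..b}" by (auto simp: le_Suc_eq)
    then show ?thesis using False by (simp add: l_def)
  qed
  \<comment> \<open>The case \<open>v = Suc b\<close> is included since a cut at \<open>v\<close>
    itself does not divide the band; it bounds the growth of the count up to a cut at
    \<open>Suc b\<close>.\<close>
  have gap: "band S 0 v \<le> band S 0 (l b) + G" if "v \<le> Suc b" "l b \<le> v" for b v
  proof -
    have "y \<le> l b" if "y \<in> Y" "y \<le> b" for y
      unfolding l_def using that by (intro Max_ge) auto
    then have "Y \<inter> {l b<..<v} = {}" using that by fastforce
    then have "band S (l b) v \<le> G" using assms(2) by (auto simp: is_net_def)
    moreover have "band S 0 v = band S 0 (l b) + band S (l b) v"
      unfolding band_def using assms(1) that
      by (subst card_Un_disjoint[symmetric]) (auto intro!: arg_cong[of _ _ card])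
    ultimately show ?thesis by simp
  qed
  have q_Suc: "q (Suc b) = q b \<or> (Suc b \<in> Y \<and> q (Suc b) = Suc (q b))" for b
  proof (cases "Suc b \<in> Y")
    case True
    then have l: "l (Suc b) = Suc b" by (simp add: l_Suc)
    have "q b \<le> q (Suc b)" unfolding q_def l using l_le[of b]
      by (intro div_le_mono band_mono[OF assms(1)]) auto
    moreover have "q (Suc b) \<le> (band S 0 (l b) + G) div G" unfolding q_def l
      using gap[of "Suc b" b] l_le[of b] by (intro div_le_mono) auto
    moreover have "(band S 0 (l b) + G) div G = Suc (q b)" using assms(3) by (simp add: q_def)
    ultimately show ?thesis using True by linarith
  qed (simp add: q_def l_Suc)
  have q_0: "q 0 = 0" by (simp add: q_def l_0 band_def)
  define Z where "Z = {Suc b |b. q (Suc b) = Suc (q b)}"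
  have Zq: "card (Z \<inter> {..b}) = q b" for b
    unfolding Z_def using q_Suc by (intro unit_steps_count q_0) blast
  show ?thesis
  proof (rule that)
    show "Z \<subseteq> Y" unfolding Z_def using q_Suc by force
    fix b
    have "G * q b \<le> band S 0 (l b)" by (simp add: q_def)
    moreover have "band S 0 (l b) \<le> band S 0 b"
      by (intro band_mono[OF assms(1)]) (auto simp: l_le)
    moreover have "band S 0 (l b) \<le> G * q b + G"
    proof -
      have "band S 0 (l b) = G * q b + band S 0 (l b) mod G" by (simp add: q_def)
      moreover have "band S 0 (l b) mod G < G" using assms(3) by simp
      ultimately show ?thesis by linarith
    qed
    moreover have "band S 0 b \<le> band S 0 (l b) + G" using gap[of b b] l_le[of b] by simp
    ultimately show "G * card (Z \<inter> {..b}) \<le> band S 0 b \<and> band S 0 b \<le> G * card (Z \<inter> {..b}) + 2 * G"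
      unfolding Zq by linarith
  qed
qed

subsection \<open>The family of sketches\<close>

text \<open>Take the least \<open>m\<close> with at least half of the points in columns up to
  \<open>m\<close>. Many points may share a column, so column \<open>m\<close> is left out of both
  sides to keep them at most half.\<close>

lemma median_split:
  fixes S :: "(nat \<times> nat) set"
  assumes "finite S" "S \<noteq> {}" "\<And>p. p \<in> S \<Longrightarrow> fst p < M"
  obtains m where "m < M" "2 * card {p \<in> S. fst p < m} \<le> card S" "2 * card {p \<in> S. m < fst p} \<le> card S"
proof -
  let ?good = "\<lambda>m. card S \<le> 2 * card {p \<in> S. fst p \<le> m}"
  define m where "m = (LEAST m. ?good m)"
  have "M > 0" using assms(2,3) by fastforce
  have "{p \<in> S. fst p \<le> M - 1} = S" using assms(3) by fastforce
  then have ex: "?good (M - 1)" by simp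
  have m: "?good m" unfolding m_def using ex by (rule LeastI)
  have "m \<le> M - 1" unfolding m_def using ex by (rule Least_le)
  then have "m < M" using \<open>M > 0\<close> by simp
  moreover have "2 * card {p \<in> S. fst p < m} \<le> card S"
  proof (cases m)
    case (Suc k)
    then have "\<not> ?good k" using not_less_Least[of k ?good] unfolding m_def by simp
    moreover have "{p \<in> S. fst p < m} = {p \<in> S. fst p \<le> k}" using Suc by auto
    ultimately show ?thesis by simp
  qed simp
  moreover have "2 * card {p \<in> S. m < fst p} \<le> card S"
  proof -
    have "card S = card {p \<in> S. fst p \<le> m} + card {p \<in> S. m < fst p}"
      using assms(1) by (subst card_Un_disjoint[symmetric]) (auto intro!: arg_cong[of _ _ card])
    then show ?thesis using m by simp
  qed
  ultimately show ?thesis by (rule that)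
qed

text \<open>A query at an inner node: \<open>f\<close> and \<open>g\<close> are the sketches of the
  left and right child. The term with \<open>Z\<close> estimates the count for all columns up to
  \<open>m\<close>, including column \<open>m\<close>, which belongs to no child. Only one child is
  consulted.\<close>

definition join :: "nat \<Rightarrow> nat \<Rightarrow> nat set \<Rightarrow> (nat \<Rightarrow> nat \<Rightarrow> nat) \<Rightarrow> (nat \<Rightarrow> nat \<Rightarrow> nat) \<Rightarrow> nat \<Rightarrow> nat \<Rightarrow> nat" where
  "join G m Z f g = (\<lambda>a b. if a \<le> m then f a b else G * card (Z \<inter> {..b}) + g a b)"

text \<open>All that an inner node may record: median, sizes of the children, their nets, and the
  jumps of the rounded counts. The sum of sizes may fall short of \<open>N\<close> because of the
  median column.\<close>

definition splits :: "nat \<Rightarrow> nat \<Rightarrow> nat \<Rightarrow> nat set \<Rightarrow> (nat \<times> nat \<times> nat \<times> nat set \<times> nat set \<times> nat set) set" where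
  "splits M G N Y = {(m, Nl, Nr, Yl, Yr, Z). m < M \<and> Nl + Nr \<le> N \<and> Yl \<subseteq> Y \<and> Yr \<subseteq> Y \<and> Z \<subseteq> Y \<and>
      G * card Yl \<le> 2 * Nl \<and> G * card Yr \<le> 2 * Nr}"

text \<open>
  \<open>sketches M G t h N Y\<close> contains a dominance sketch for every set of \<open>N\<close> points with abscissae below
  \<open>M\<close> and net \<open>Y\<close>; \<open>h\<close> bounds the height of the tree and sets of at most \<open>t\<close> points are ignored.
\<close>

primrec sketches :: "nat \<Rightarrow> nat \<Rightarrow> nat \<Rightarrow> nat \<Rightarrow> nat \<Rightarrow> nat set \<Rightarrow> (nat \<Rightarrow> nat \<Rightarrow> nat) set" where
  "sketches M G t 0 = (\<lambda>N Y. {\<lambda>_ _. 0})"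
| "sketches M G t (Suc h) = (\<lambda>N Y. if N \<le> t then {\<lambda>_ _. 0} else
     (\<Union>(m, Nl, Nr, Yl, Yr, Z) \<in> splits M G N Y.
        (\<lambda>(f, g). join G m Z f g) ` (sketches M G t h Nl Yl \<times> sketches M G t h Nr Yr)))"

lemma dom_count_split:
  assumes "finite S"
  shows "dom_count S a b = (if a \<le> m then dom_count {p \<in> S. fst p < m} a b
           else band {p \<in> S. fst p \<le> m} 0 b + dom_count {p \<in> S. m < fst p} a b)"
proof (cases "a \<le> m")
  case True
  then show ?thesis unfolding dom_count_def by (auto intro!: arg_cong[of _ _ card])
next
  case False
  then show ?thesis unfolding dom_count_def band_def using assms
    by (subst card_Un_disjoint[symmetric]) (auto intro!: arg_cong[of _ _ card])
qed

lemma dom_count_le: "finite S \<Longrightarrow> dom_count S a b \<le> card S"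
  unfolding dom_count_def by (intro card_mono) auto

text \<open>A query follows one path: it loses at most \<open>t\<close> where the path ends and at
  most \<open>2 * G\<close> at each level where it turns right. Halving passes the bound
  \<open>t * 2 ^ h\<close> on to the children.\<close>

lemma sketches_cover:
  assumes "finite S" "\<And>p. p \<in> S \<Longrightarrow> fst p < M" "is_net G Y S" "G \<ge> 1" "card S \<le> t * 2 ^ h"
  shows "\<exists>f \<in> sketches M G t h (card S) Y. \<forall>a b.
           f a b \<le> dom_count S a b \<and> dom_count S a b \<le> f a b + t + 2 * G * h"
  using assms(1,2,3,5)
proof (induction h arbitrary: S Y)
  case 0
  then have "dom_count S a b \<le> t" for a b
    using dom_count_le[of S a b] by simp
  then show ?case by simp
next
  case (Suc h)
  show ?case
  proof (cases "card S \<le> t")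
    case True
    then have "dom_count S a b \<le> t" for a b
      using dom_count_le[OF Suc.prems(1), of a b] by simp
    then show ?thesis using True by (simp add: trans_le_add1)
  next
    case False
    then have "S \<noteq> {}" by auto
    obtain m where m: "m < M" "2 * card {p \<in> S. fst p < m} \<le> card S" "2 * card {p \<in> S. m < fst p} \<le> card S"
      using median_split[OF Suc.prems(1) \<open>S \<noteq> {}\<close> Suc.prems(2)] by blast
    let ?L = "{p \<in> S. fst p < m}" and ?R = "{p \<in> S. m < fst p}" and ?C = "{p \<in> S. fst p \<le> m}"
    have fin: "finite ?L" "finite ?R" "finite ?C" using Suc.prems(1) by auto
    have nets: "is_net G Y ?L" "is_net G Y ?R" "is_net G Y ?C"
      by (rule is_net_mono[OF Suc.prems(3,1)]; blast)+
    obtain Yl where Yl: "Yl \<subseteq> Y" "is_net G Yl ?L" "G * card Yl \<le> 2 * card ?L"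
      using thin_net[OF fin(1) nets(1)] by blast
    obtain Yr where Yr: "Yr \<subseteq> Y" "is_net G Yr ?R" "G * card Yr \<le> 2 * card ?R"
      using thin_net[OF fin(2) nets(2)] by blast
    obtain Z where Z: "Z \<subseteq> Y"
      "\<And>b. G * card (Z \<inter> {..b}) \<le> band ?C 0 b \<and> band ?C 0 b \<le> G * card (Z \<inter> {..b}) + 2 * G"
      using net_rank_estimate[OF fin(3) nets(3) assms(4)] by blast
    have "card ?L \<le> t * 2 ^ h" "card ?R \<le> t * 2 ^ h" using m(2,3) Suc.prems(4) by auto
    then obtain f g where f: "f \<in> sketches M G t h (card ?L) Yl"
        "\<And>a b. f a b \<le> dom_count ?L a b \<and> dom_count ?L a b \<le> f a b + t + 2 * G * h"
      and g: "g \<in> sketches M G t h (card ?R) Yr"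
        "\<And>a b. g a b \<le> dom_count ?R a b \<and> dom_count ?R a b \<le> g a b + t + 2 * G * h"
      using Suc.IH[OF fin(1) _ Yl(2)] Suc.IH[OF fin(2) _ Yr(2)] Suc.prems(2) by (metis (lifting) mem_Collect_eq)
    have "card ?L + card ?R = card (?L \<union> ?R)" using fin by (intro card_Un_disjoint[symmetric]) auto
    also have "\<dots> \<le> card S" using Suc.prems(1) by (intro card_mono) auto
    finally have "(m, card ?L, card ?R, Yl, Yr, Z) \<in> splits M G (card S) Y"
      using m(1) Yl Yr Z(1) by (simp add: splits_def)
    then have mem: "join G m Z f g \<in> sketches M G t (Suc h) (card S) Y"
      using False f(1) g(1) by (simp, intro bexI) auto
    have "join G m Z f g a b \<le> dom_count S a b \<and>
          dom_count S a b \<le> join G m Z f g a b + t + 2 * G * Suc h" for a b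
      using f(2)[of a b] g(2)[of a b] Z(2)[of b]
      unfolding join_def dom_count_split[OF Suc.prems(1), of a b m] by (simp add: algebra_simps)
    with mem show ?thesis by blast
  qed
qed

section \<open>Counting the sketches\<close>

lemma card_splits:
  assumes "finite Y"
  shows "finite (splits M G N Y)" "card (splits M G N Y) \<le> M * (N + 1) ^ 2 * 2 ^ (3 * card Y)"
proof -
  let ?B = "{..<M} \<times> {..N} \<times> {..N} \<times> Pow Y \<times> Pow Y \<times> Pow Y"
  have sub: "splits M G N Y \<subseteq> ?B" by (auto simp: splits_def)
  have fin: "finite ?B" using assms by simp
  show "finite (splits M G N Y)" using sub fin by (rule finite_subset)
  have "card ?B = M * (N + 1) ^ 2 * 2 ^ (3 * card Y)"
  proof -
    have "card ?B = M * ((N + 1) * ((N + 1) * (2 ^ card Y * (2 ^ card Y * 2 ^ card Y))))"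
      using assms by (simp only: card_cartesian_product card_Pow card_lessThan card_atMost Suc_eq_plus1)
    also have "\<dots> = M * (N + 1) ^ 2 * 2 ^ (card Y + (card Y + card Y))"
      by (simp only: power_add power2_eq_square mult.assoc)
    finally show ?thesis by (simp only: numeral_3_eq_3 mult_Suc mult_0 add_0_right)
  qed
  then show "card (splits M G N Y) \<le> M * (N + 1) ^ 2 * 2 ^ (3 * card Y)"
    using card_mono[OF fin sub] by simp
qed

text \<open>\<open>W\<close> bits pay for the median and the two sizes, three bits per cut for the
  three subsets of \<open>Y\<close>. Each level charges \<open>W / t + 6 / G\<close> bits to every
  point; the cuts of the node itself stay a separate term, which its parent pays.\<close>

lemma card_sketches:
  assumes "finite Y" "N \<le> n" "G \<ge> 1" "t \<ge> 1" "real (M * (n + 1) ^ 2) \<le> 2 powr W" "W \<ge> 0"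
  shows "finite (sketches M G t h N Y) \<and>
         real (card (sketches M G t h N Y)) \<le> 2 powr (3 * real (card Y) + real h * N * (W / t + 6 / G))"
  using assms(1,2)
proof (induction h arbitrary: N Y)
  case 0
  then show ?case by (simp add: ge_one_powr_ge_zero)
next
  case (Suc h)
  let ?c = "W / t + 6 / G"
  have c: "?c \<ge> 0" using assms by simp
  show ?case
  proof (cases "N \<le> t")
    case True
    then show ?thesis using c by (simp add: ge_one_powr_ge_zero)
  next
    case False
    let ?X = "splits M G N Y"
    define F where "F = (\<lambda>(m, Nl, Nr, Yl, Yr, Z).
        (\<lambda>(f, g). join G m Z f g) ` (sketches M G t h Nl Yl \<times> sketches M G t h Nr Yr))"
    have eq: "sketches M G t (Suc h) N Y = (\<Union>x \<in> ?X. F x)"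
      using False by (simp add: F_def)
    \<comment> \<open>Exponent for both children together: at most \<open>2 * N / G\<close> cuts at
      three bits each, and the charges of the \<open>h\<close> lower levels.\<close>
    define B where "B = 6 * N / G + real h * N * ?c"
    have each: "finite (F x) \<and> real (card (F x)) \<le> 2 powr B" if x: "x \<in> ?X" for x
    proof -
      obtain m Nl Nr Yl Yr Z where xe: "x = (m, Nl, Nr, Yl, Yr, Z)" by (cases x)
      have X: "Nl + Nr \<le> N" "Yl \<subseteq> Y" "Yr \<subseteq> Y" "G * card Yl \<le> 2 * Nl" "G * card Yr \<le> 2 * Nr"
        using x unfolding xe splits_def by auto
      let ?l = "sketches M G t h Nl Yl" and ?r = "sketches M G t h Nr Yr"
      have fin: "finite Yl" "finite Yr" using X Suc.prems(1) finite_subset by blast+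
      have l: "finite ?l" "real (card ?l) \<le> 2 powr (3 * real (card Yl) + real h * Nl * ?c)"
        using Suc.IH[OF fin(1), of Nl] X Suc.prems(2) by auto
      have r: "finite ?r" "real (card ?r) \<le> 2 powr (3 * real (card Yr) + real h * Nr * ?c)"
        using Suc.IH[OF fin(2), of Nr] X Suc.prems(2) by auto
      have "real (card (F x)) \<le> real (card (?l \<times> ?r))"
        unfolding F_def xe prod.case of_nat_le_iff using l(1) r(1) by (intro card_image_le) simp
      also have "\<dots> = real (card ?l) * real (card ?r)" by (simp add: card_cartesian_product)
      also have "\<dots> \<le> 2 powr (3 * real (card Yl) + real h * Nl * ?c) * 2 powr (3 * real (card Yr) + real h * Nr * ?c)"
        using l(2) r(2) by (intro mult_mono) auto
      also have "\<dots> = 2 powr (3 * (real (card Yl) + real (card Yr)) + real h * (real Nl + real Nr) * ?c)"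
        by (simp add: powr_add[symmetric] algebra_simps)
      also have "\<dots> \<le> 2 powr B"
      proof -
        have "real G * card Yl \<le> 2 * Nl" "real G * card Yr \<le> 2 * Nr"
          using X(4,5) by (metis of_nat_le_iff of_nat_mult of_nat_numeral)+
        then have "real G * (real (card Yl) + real (card Yr)) \<le> 2 * (real Nl + real Nr)"
          by (simp add: algebra_simps)
        also have "\<dots> \<le> 2 * real N" using X(1) by simp
        finally have "3 * (real (card Yl) + real (card Yr)) \<le> 6 * N / G"
          using assms(3) by (simp add: field_simps)
        moreover have "real h * (real Nl + real Nr) * ?c \<le> real h * N * ?c"
          using X(1) c by (intro mult_right_mono mult_left_mono) auto
        ultimately show ?thesis unfolding B_def by simp
      qed
      finally show ?thesis using l(1) r(1) by (simp add: F_def xe)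
    qed
    have finX: "finite ?X" using card_splits(1)[OF Suc.prems(1)] .
    have "real (card (\<Union>x \<in> ?X. F x)) \<le> real (\<Sum>x \<in> ?X. card (F x))"
      unfolding of_nat_le_iff by (rule card_UN_le[OF finX])
    also have "\<dots> = (\<Sum>x \<in> ?X. real (card (F x)))" by (rule of_nat_sum)
    also have "\<dots> \<le> real (card ?X) * 2 powr B"
      using each by (intro sum_bounded_above) auto
    also have "\<dots> \<le> (2 powr W * 2 powr (3 * real (card Y))) * 2 powr B"
    proof (rule mult_right_mono)
      have "real (card ?X) \<le> real (M * (N + 1) ^ 2 * 2 ^ (3 * card Y))"
        using card_splits(2)[OF Suc.prems(1), of M G N] by (simp only: of_nat_le_iff)
      also have "\<dots> \<le> real (M * (n + 1) ^ 2 * 2 ^ (3 * card Y))"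
        using Suc.prems(2) unfolding of_nat_le_iff by (intro mult_le_mono power_mono) auto
      also have "\<dots> = real (M * (n + 1) ^ 2) * 2 powr (3 * real (card Y))"
        using powr_realpow[of 2 "3 * card Y"] by simp
      also have "\<dots> \<le> 2 powr W * 2 powr (3 * real (card Y))"
        using assms(5) by (intro mult_right_mono) auto
      finally show "real (card ?X) \<le> 2 powr W * 2 powr (3 * real (card Y))" .
    qed simp
    also have "\<dots> = 2 powr (W + 3 * real (card Y) + B)" by (simp add: powr_add)
    also have "\<dots> \<le> 2 powr (3 * real (card Y) + real (Suc h) * N * ?c)"
    proof -
      \<comment> \<open>Only nodes with more than \<open>t\<close> points are split, so these points
        can carry the cost \<open>W\<close>.\<close>
      have "W \<le> N * (W / t)" using False assms(4,6) mult_left_mono[of "real t" "real N" W]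
        by (simp add: field_simps)
      then have "W + 6 * N / G \<le> N * ?c" by (simp add: algebra_simps)
      then show ?thesis unfolding B_def by (simp add: algebra_simps)
    qed
    finally show ?thesis unfolding eq using each finX by auto
  qed
qed


section \<open>From a finite family to bit strings\<close>

text \<open>Members of \<open>F\<close> are numbered injectively by strings of one common length,
  \<open>B\<close> rounded up. The decoder depends on the family only, not on the encoded
  object.\<close>

lemma encode_family:
  fixes F :: "'f set" and good :: "'p \<Rightarrow> 'f \<Rightarrow> bool"
  assumes "finite F" "real (card F) \<le> 2 powr B" "B \<ge> 0" "\<And>p. p \<in> A \<Longrightarrow> \<exists>f \<in> F. good p f"
  obtains E :: "'p \<Rightarrow> bool list" and D :: "bool list \<Rightarrow> 'f" where
    "\<forall>p \<in> A. real (length (E p)) \<le> B + 1 \<and> good p (D (E p))"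
proof -
  define k where "k = nat \<lceil>B\<rceil>"
  have k: "B \<le> real k" "real k \<le> B + 1" unfolding k_def using assms(3) by linarith+
  let ?L = "{xs :: bool list. set xs \<subseteq> UNIV \<and> length xs = k}"
  have finL: "finite ?L" by (rule finite_lists_length_eq) simp
  have "real (card F) \<le> 2 powr k" using assms(2) k(1) by (meson order_trans powr_mono one_le_numeral)
  also have "\<dots> = real (card ?L)" by (simp add: card_lists_length_eq[of UNIV, simplified] powr_realpow)
  finally have "card F \<le> card ?L" by linarith
  then obtain g where g: "g ` F \<subseteq> ?L" "inj_on g F"
    using card_le_inj[OF assms(1) finL] by blast
  define pick where "pick p = (SOME f. f \<in> F \<and> good p f)" for p
  have pick: "pick p \<in> F \<and> good p (pick p)" if "p \<in> A" for p
    unfolding pick_def using assms(4)[OF that] someI_ex[of "\<lambda>f. f \<in> F \<and> good p f"] by blast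
  show ?thesis
  proof (rule that[of "\<lambda>p. g (pick p)" "inv_into F g"], rule ballI)
    fix p assume "p \<in> A"
    then show "real (length (g (pick p))) \<le> B + 1 \<and> good p (inv_into F g (g (pick p)))"
      using pick[of p] g k(2) by auto
  qed
qed

subsection \<open>Rectangles in the real grid\<close>

text \<open>Breaks ties in y-direction, without which nets with small gaps need not exist.\<close>

definition shear :: "nat \<Rightarrow> nat \<times> nat \<Rightarrow> nat \<times> nat" where
  "shear n = (\<lambda>(x, y). (x, y * n + x))"

text \<open>The sheared height has \<open>y\<close> and \<open>x\<close> as its
  base-\<open>n\<close> digits, so a threshold at a multiple of \<open>n\<close> sees only
  \<open>y\<close>. Hence the shear separates equal heights without changing the answers to
  queries.\<close>

lemma shear_snd_less_iff:
  fixes x y b n :: nat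
  assumes "x < n"
  shows "y * n + x < b * n \<longleftrightarrow> y < b"
proof
  assume "y < b"
  then have "Suc y * n \<le> b * n" by (intro mult_le_mono1) simp
  then show "y * n + x < b * n" using assms by simp
next
  assume "y * n + x < b * n"
  then have "y * n < b * n" by linarith
  then show "y < b" by simp
qed

lemma inj_on_snd_shear: "inj_on (\<lambda>p. snd (shear n p)) ({..<n} \<times> {..<n})"
proof (rule inj_onI)
  fix p q assume a: "p \<in> {..<n} \<times> {..<n}" "q \<in> {..<n} \<times> {..<n}" "snd (shear n p) = snd (shear n q)"
  obtain x y x' y' where pq: "p = (x, y)" "q = (x', y')" by fastforce
  have e: "y * n + x = y' * n + x'" and l: "x < n" "x' < n" using a by (auto simp: pq shear_def)
  have "(y * n + x) mod n = x" "(y' * n + x') mod n = x'" using l by auto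
  then have "x = x'" using e by simp
  then show "p = q" using e l by (simp add: pq)
qed

lemma dom_count_shear:
  assumes "T \<subseteq> {..<n} \<times> {..<n}"
  shows "dom_count (shear n ` T) a (b * n) = dom_count T a b"
proof -
  have inj: "inj_on (shear n) T"
    using inj_on_subset[OF inj_on_snd_shear assms] unfolding inj_on_def by metis
  have "{p \<in> shear n ` T. fst p < a \<and> snd p < b * n} = shear n ` {p \<in> T. fst p < a \<and> snd p < b}"
    using assms by (fastforce simp: shear_def shear_snd_less_iff)
  then show ?thesis unfolding dom_count_def
    by (simp add: card_image inj_on_subset[OF inj])
qed

lemma card_rectangle:
  assumes "finite T" "x1 \<le> x2" "y1 \<le> y2"
  shows "int (card {p \<in> T. x1 \<le> fst p \<and> fst p < x2 \<and> y1 \<le> snd p \<and> snd p < y2}) =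
    int (dom_count T x2 y2) - dom_count T x1 y2 - dom_count T x2 y1 + dom_count T x1 y1"
proof -
  have strip: "dom_count T x2 b = dom_count T x1 b + card {p \<in> T. x1 \<le> fst p \<and> fst p < x2 \<and> snd p < b}" for b
    unfolding dom_count_def using assms
    by (subst card_Un_disjoint[symmetric]) (auto intro!: arg_cong[of _ _ card])
  have "card {p \<in> T. x1 \<le> fst p \<and> fst p < x2 \<and> snd p < y2} =
      card {p \<in> T. x1 \<le> fst p \<and> fst p < x2 \<and> snd p < y1} +
      card {p \<in> T. x1 \<le> fst p \<and> fst p < x2 \<and> y1 \<le> snd p \<and> snd p < y2}"
    using assms by (subst card_Un_disjoint[symmetric]) (auto intro!: arg_cong[of _ _ card])
  then show ?thesis using strip[of y1] strip[of y2] by simp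
qed

text \<open>The choice recovers the sides from the set \<open>R\<close>. Rounding turns the closed
  real intervals into half-open integer ones, with \<open>nat\<close> cutting off negative values;
  the factor \<open>n\<close> accounts for the shear.\<close>

definition rect_estimate :: "nat \<Rightarrow> (nat \<Rightarrow> nat \<Rightarrow> nat) \<Rightarrow> (real \<times> real) set \<Rightarrow> real" where
  "rect_estimate n f R = (case (SOME (a, b, c, d). a \<le> b \<and> c \<le> d \<and> R = {a..b} \<times> {c..d}) of
     (a, b, c, d) \<Rightarrow>
       let x1 = nat \<lceil>a\<rceil>; x2 = nat (\<lfloor>b\<rfloor> + 1); y1 = nat \<lceil>c\<rceil> * n; y2 = nat (\<lfloor>d\<rfloor> + 1) * n
       in real (f x2 y2) - real (f x1 y2) - real (f x2 y1) + real (f x1 y1))"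

definition int_points :: "(real \<times> real) set \<Rightarrow> (nat \<times> nat) set" where
  "int_points P = {(x, y). (real x, real y) \<in> P}"

text \<open>All four dominance estimates err in the same direction and enter with two plus and two
  minus signs, hence the factor 2 rather than 4.\<close>

lemma rect_estimate_error:
  assumes "P \<subseteq> grid n" "axis_parallel_rectangle R"
    and f: "\<And>a b. f a b \<le> dom_count (shear n ` int_points P) a b \<and>
                 dom_count (shear n ` int_points P) a b \<le> f a b + e"
  shows "\<bar>rect_estimate n f R - real (card (P \<inter> R))\<bar> \<le> 2 * real e"
proof -
  let ?T = "int_points P"
  have T: "?T \<subseteq> {..<n} \<times> {..<n}" using assms(1) by (auto simp: int_points_def grid_def)
  then have finT: "finite ?T" by (rule finite_subset) simp
  let ?ok = "\<lambda>(a, b, c, d). a \<le> b \<and> c \<le> d \<and> R = {a..b} \<times> {c..d}"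
  obtain a b c d where s: "Eps ?ok = (a, b, c, d)" by (cases "Eps ?ok")
  have "\<exists>q. ?ok q" using assms(2) by (auto simp: axis_parallel_rectangle_def)
  then have "?ok (Eps ?ok)" by (rule someI_ex)
  then have R: "a \<le> b" "c \<le> d" "R = {a..b} \<times> {c..d}" unfolding s by auto
  define x1 x2 y1 y2 where v: "x1 = nat \<lceil>a\<rceil>" "x2 = nat (\<lfloor>b\<rfloor> + 1)" "y1 = nat \<lceil>c\<rceil>" "y2 = nat (\<lfloor>d\<rfloor> + 1)"
  have lo: "a \<le> real x \<longleftrightarrow> nat \<lceil>a\<rceil> \<le> x" for a x by linarith
  have hi: "real x \<le> b \<longleftrightarrow> x < nat (\<lfloor>b\<rfloor> + 1)" for b x by linarith
  \<comment> \<open>This holds even if a side contains no integer, as the ceiling of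
    \<open>a\<close> is at most the floor of \<open>a\<close> plus one.\<close>
  have "x1 \<le> x2" "y1 \<le> y2" using R(1,2) unfolding v by linarith+
  note rect = card_rectangle[OF finT this]
  let ?B = "{p \<in> ?T. x1 \<le> fst p \<and> fst p < x2 \<and> y1 \<le> snd p \<and> snd p < y2}"
  have "P \<inter> R = (\<lambda>(x, y). (real x, real y)) ` ?B"
    using assms(1) by (auto simp: R(3) int_points_def grid_def v lo[symmetric] hi[symmetric] image_iff)
  moreover have "inj_on (\<lambda>(x, y). (real x, real y)) ?B" by (auto simp: inj_on_def)
  ultimately have "card (P \<inter> R) = card ?B" by (simp add: card_image)
  then have cnt: "int (card (P \<inter> R)) = int (dom_count ?T x2 y2) - dom_count ?T x1 y2 - dom_count ?T x2 y1 + dom_count ?T x1 y1"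
    using rect by simp
  have est: "rect_estimate n f R = real (f x2 (y2 * n)) - real (f x1 (y2 * n)) - real (f x2 (y1 * n)) + real (f x1 (y1 * n))"
    unfolding rect_estimate_def s by (simp add: v Let_def)
  have f': "f a (b * n) \<le> dom_count ?T a b \<and> dom_count ?T a b \<le> f a (b * n) + e" for a b
    using f[of a "b * n"] unfolding dom_count_shear[OF T] .
  show ?thesis unfolding est using f'[of x1 y1] f'[of x1 y2] f'[of x2 y1] f'[of x2 y2] cnt by linarith
qed

text \<open>The families below are built for this class, which contains all sheared inputs, and so
  never refer to the shear itself.\<close>

definition sheared_sets :: "nat \<Rightarrow> (nat \<times> nat) set set" where
  "sheared_sets n = {S. S \<subseteq> {..<n} \<times> {..<n * n} \<and> inj_on snd S \<and> card S = n}"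

lemma sheared_int_points:
  assumes "P \<subseteq> grid n" "card P = n"
  shows "shear n ` int_points P \<in> sheared_sets n"
proof -
  let ?T = "int_points P"
  have T: "?T \<subseteq> {..<n} \<times> {..<n}" using assms(1) by (auto simp: int_points_def grid_def)
  have "P = (\<lambda>(x, y). (real x, real y)) ` ?T"
    using assms(1) by (auto simp: int_points_def grid_def image_iff)
  moreover have "inj_on (\<lambda>(x, y). (real x, real y)) ?T" by (auto simp: inj_on_def)
  ultimately have "card ?T = n" using assms(2) card_image by metis
  moreover have inj: "inj_on (\<lambda>p. snd (shear n p)) ?T" using inj_on_subset[OF inj_on_snd_shear T] .
  then have "inj_on (shear n) ?T" unfolding inj_on_def by metis
  ultimately have "card (shear n ` ?T) = n" by (simp add: card_image)
  moreover have "inj_on snd (shear n ` ?T)" using inj by (auto simp: inj_on_def)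
  moreover have "shear n ` ?T \<subseteq> {..<n} \<times> {..<n * n}"
    using T shear_snd_less_iff[of _ n _ n] by (auto simp: shear_def)
  ultimately show ?thesis by (simp add: sheared_sets_def)
qed

subsection \<open>Size of the data structure\<close>

definition approx_family :: "nat \<Rightarrow> nat \<Rightarrow> (nat \<Rightarrow> nat \<Rightarrow> nat) set \<Rightarrow> bool" where
  "approx_family n e F \<longleftrightarrow> finite F \<and> (\<forall>S \<in> sheared_sets n. \<exists>f \<in> F. \<forall>a b.
     f a b \<le> dom_count S a b \<and> dom_count S a b \<le> f a b + e)"

text \<open>Listing the \<open>n\<close> points costs at most \<open>3 * log 2 n\<close> bits for
  each, as there are \<open>n ^ 3\<close> possible positions.\<close>

lemma exact_family:
  assumes "n \<ge> 2"
  obtains F where "approx_family n 0 F" "real (card F) \<le> 2 powr (3 * real n * log 2 n)"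
proof -
  let ?A = "{..<n} \<times> {..<n * n}"
  let ?K = "{xs. set xs \<subseteq> ?A \<and> length xs = n}"
  let ?F = "(\<lambda>xs. dom_count (set xs)) ` ?K"
  have fin: "finite ?K" by (rule finite_lists_length_eq) simp
  have "\<exists>f \<in> ?F. \<forall>a b. f a b \<le> dom_count S a b \<and> dom_count S a b \<le> f a b + 0" if "S \<in> sheared_sets n" for S
  proof -
    have S: "S \<subseteq> ?A" "card S = n" using that by (auto simp: sheared_sets_def)
    then have "finite S" using finite_subset by blast
    then obtain xs where xs: "set xs = S" "distinct xs" using finite_distinct_list by blast
    then have "length xs = n" using S(2) distinct_card by fastforce
    then have "xs \<in> ?K" using xs S by simp
    then show ?thesis using xs(1) by force
  qed
  then have "approx_family n 0 ?F" using fin by (auto simp: approx_family_def)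
  moreover have "real (card ?F) \<le> 2 powr (3 * real n * log 2 n)"
  proof -
    have "card ?F \<le> card ?K" using fin by (rule card_image_le)
    also have "\<dots> = (n ^ 3) ^ n"
      by (subst card_lists_length_eq) (simp_all add: card_cartesian_product power3_eq_cube mult.assoc)
    finally have "real (card ?F) \<le> real ((n ^ 3) ^ n)" by (simp only: of_nat_le_iff)
    also have "\<dots> = real n powr (3 * n)"
      using assms powr_realpow[of "real n" "3 * n"] by (simp add: power_mult)
    also have "\<dots> = 2 powr (3 * real n * log 2 n)"
      using assms by (simp add: powr_def log_def)
    finally show ?thesis .
  qed
  ultimately show ?thesis by (rule that)
qed

text \<open>Only the root net is written out, as a list of heights, and every other net is a subset
  of it. With \<open>k\<close> at most \<open>3 * n / G\<close> entries, the list and the three bits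
  per root cut cost at most \<open>6 * k * log 2 n\<close> bits, which gives the constant
  18.\<close>

lemma sketch_family:
  assumes "n \<ge> 2" "G \<ge> 1" "t \<ge> 1" "G \<le> n" "n \<le> t * 2 ^ h"
  obtains F where "approx_family n (t + 2 * G * h) F"
    "real (card F) \<le> 2 powr (18 * real n / real G * log 2 n + real h * n * (5 * log 2 n / t + 6 / G))"
proof -
  define k where "k = 3 * n div G"
  let ?K = "{xs. set xs \<subseteq> {..n * n} \<and> length xs = k}"
  let ?F = "\<Union>xs \<in> ?K. sketches n G t h n (set xs)"
  have finK: "finite ?K" by (rule finite_lists_length_eq) simp
  let ?W = "5 * log 2 n"
  have n_powr: "real (n ^ j) = 2 powr (j * log 2 n)" for j
    using assms(1) by (simp add: powr_realpow[symmetric] powr_def log_def)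
  have log_ge: "log 2 n \<ge> 1" using assms(1) by simp
  have W: "real (n * (n + 1) ^ 2) \<le> 2 powr ?W"
  proof -
    have "2 * n \<le> n * n" using assms(1) by (intro mult_le_mono1)
    then have "n + 1 \<le> n ^ 2" using assms(1) unfolding power2_eq_square by linarith
    then have "n * (n + 1) ^ 2 \<le> n * (n ^ 2) ^ 2" by (intro mult_le_mono power_mono) auto
    also have "\<dots> = n ^ 5" by (simp add: eval_nat_numeral)
    finally have "real (n * (n + 1) ^ 2) \<le> real (n ^ 5)" by (simp only: of_nat_le_iff)
    then show ?thesis unfolding n_powr by simp
  qed
  have sk: "finite (sketches n G t h n (set xs)) \<and> real (card (sketches n G t h n (set xs)))
      \<le> 2 powr (3 * real k + real h * n * (?W / t + 6 / G))" if "xs \<in> ?K" for xs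
  proof -
    have "card (set xs) \<le> k" using that card_length[of xs] by simp
    then have "2 powr (3 * real (card (set xs)) + real h * n * (?W / t + 6 / G))
        \<le> 2 powr (3 * real k + real h * n * (?W / t + 6 / G))" by simp
    moreover have "finite (sketches n G t h n (set xs)) \<and> real (card (sketches n G t h n (set xs)))
        \<le> 2 powr (3 * real (card (set xs)) + real h * n * (?W / t + 6 / G))"
      using W assms log_ge by (intro card_sketches) auto
    ultimately show ?thesis by (meson order_trans)
  qed
  have "\<exists>f \<in> ?F. \<forall>a b. f a b \<le> dom_count S a b \<and> dom_count S a b \<le> f a b + (t + 2 * G * h)"
    if "S \<in> sheared_sets n" for S
  proof -
    have S: "S \<subseteq> {..<n} \<times> {..<n * n}" "inj_on snd S" "card S = n" using that by (auto simp: sheared_sets_def)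
    have finS: "finite S" using S(1) by (rule finite_subset) simp
    have "is_net G {..n * n} S"
      unfolding is_net_def
    proof (intro allI impI)
      fix u v assume c: "{..n * n} \<inter> {u<..<v} = {}"
      \<comment> \<open>No point has height \<open>n * n\<close> or more, so \<open>v\<close> may be
        clipped and a bounded range of cuts is enough.\<close>
      have "UNIV \<inter> {u<..<min v (n * n)} \<subseteq> {..n * n} \<inter> {u<..<v}" by auto
      then have "UNIV \<inter> {u<..<min v (n * n)} = {}" using c by blast
      then have "band S u (min v (n * n)) \<le> G"
        using is_net_UNIV[OF S(2) finS assms(2)] by (auto simp: is_net_def)
      moreover have "band S u (min v (n * n)) = band S u v"
        unfolding band_def using S(1) by (intro arg_cong[of _ _ card]) auto
      ultimately show "band S u v \<le> G" by simp
    qed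
    then obtain Y where Y: "Y \<subseteq> {..n * n}" "finite Y" "is_net G Y S" "G * card Y \<le> 2 * n"
      using thin_net[OF finS, of G "{..n * n}"] S(3) by blast
    obtain ys where ys: "set ys = Y" "length ys = card Y"
      using finite_distinct_list[OF Y(2)] distinct_card by metis
    have "(card Y + 1) * G \<le> 3 * n" using Y(4) assms(4) by (simp add: algebra_simps)
    then have "card Y + 1 \<le> k" unfolding k_def using assms(2) by (simp add: less_eq_div_iff_mult_less_eq)
    \<comment> \<open>Padding with the cut 0 gives all lists the same length; additional cuts
      preserve the net.\<close>
    define xs where "xs = ys @ replicate (k - card Y) 0"
    have "length xs = k" "Y \<subseteq> set xs" "set xs \<subseteq> {..n * n}"
      using ys \<open>card Y + 1 \<le> k\<close> Y(1) by (auto simp: xs_def)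
    then have "xs \<in> ?K" "is_net G (set xs) S" using is_net_mono[OF Y(3) finS order_refl] by auto
    then obtain f where "f \<in> sketches n G t h n (set xs)"
      "\<forall>a b. f a b \<le> dom_count S a b \<and> dom_count S a b \<le> f a b + t + 2 * G * h"
      using sketches_cover[of S n G "set xs" t h] finS S assms by fastforce
    then show ?thesis using \<open>xs \<in> ?K\<close> by (auto simp: add.assoc)
  qed
  then have "approx_family n (t + 2 * G * h) ?F" using finK sk by (auto simp: approx_family_def)
  moreover have "real (card ?F) \<le> 2 powr (18 * real n / real G * log 2 n + real h * n * (?W / t + 6 / G))"
  proof -
    have "real (card ?F) \<le> real (\<Sum>xs \<in> ?K. card (sketches n G t h n (set xs)))"
      unfolding of_nat_le_iff by (rule card_UN_le[OF finK])
    also have "\<dots> = (\<Sum>xs \<in> ?K. real (card (sketches n G t h n (set xs))))" by (rule of_nat_sum)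
    also have "\<dots> \<le> real (card ?K) * 2 powr (3 * real k + real h * n * (?W / t + 6 / G))"
      using sk by (intro sum_bounded_above) auto
    also have "\<dots> \<le> 2 powr (3 * real k * log 2 n) * 2 powr (3 * real k + real h * n * (?W / t + 6 / G))"
    proof (intro mult_right_mono)
      have "2 * (n * n) \<le> n * (n * n)" using assms(1) by (intro mult_le_mono1)
      moreover have "2 * 2 \<le> n * n" using assms(1) by (intro mult_le_mono)
      ultimately have "n * n + 1 \<le> n ^ 3" unfolding power3_eq_cube mult.assoc by linarith
      then have "card ?K \<le> (n ^ 3) ^ k"
        by (subst card_lists_length_eq) (auto intro: power_mono)
      then have "real (card ?K) \<le> real (n ^ (3 * k))" by (simp only: of_nat_le_iff power_mult)
      then show "real (card ?K) \<le> 2 powr (3 * real k * log 2 n)" unfolding n_powr by simp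
    qed simp
    also have "\<dots> = 2 powr (3 * real k * log 2 n + 3 * real k + real h * n * (?W / t + 6 / G))"
      by (simp add: powr_add[symmetric] add.assoc)
    also have "\<dots> \<le> 2 powr (18 * real n / real G * log 2 n + real h * n * (?W / t + 6 / G))"
    proof -
      have "real k \<le> 3 * n / G" unfolding k_def using of_nat_div_le_of_nat[of "3 * n" G] by simp
      then have "6 * real k * log 2 n \<le> 6 * (3 * n / G) * log 2 n"
        using log_ge by (intro mult_right_mono mult_left_mono) auto
      moreover have "3 * real k * 1 \<le> 3 * real k * log 2 n" using log_ge by (intro mult_left_mono) auto
      ultimately have "3 * real k * log 2 n + 3 * real k \<le> 18 * real n / real G * log 2 n" by (simp add: field_simps)
      then show ?thesis by simp
    qed
    finally show ?thesis .
  qed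
  ultimately show ?thesis by (rule that)
qed

section \<open>Choice of the parameters\<close>

lemma nat_floor_bounds:
  fixes x :: real
  assumes "x \<ge> 1"
  shows "real (nat \<lfloor>x\<rfloor>) \<le> x" "x / 2 \<le> real (nat \<lfloor>x\<rfloor>)" "nat \<lfloor>x\<rfloor> \<ge> 1"
proof -
  have "\<lfloor>x\<rfloor> \<ge> 1" using assms by simp
  then have "real (nat \<lfloor>x\<rfloor>) = of_int \<lfloor>x\<rfloor>" "real_of_int \<lfloor>x\<rfloor> \<ge> 1" by simp_all
  then show "real (nat \<lfloor>x\<rfloor>) \<le> x" "x / 2 \<le> real (nat \<lfloor>x\<rfloor>)" "nat \<lfloor>x\<rfloor> \<ge> 1"
    using of_int_floor_le[of x] real_of_int_floor_gt_diff_one[of x] \<open>\<lfloor>x\<rfloor> \<ge> 1\<close> by linarith+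
qed

text \<open>With \<open>h\<close> of order \<open>L\<close>, root cuts and node data cost
  \<open>O(h / \<epsilon> * l)\<close> bits and the subsets \<open>O(h * h / \<epsilon>)\<close>,
  which is no more because \<open>L \<le> l\<close> when sketches are used.\<close>

lemma small_family:
  assumes n: "n \<ge> 2" and eps: "0 < \<epsilon>" "\<epsilon> < 1/16"
  obtains F e where "approx_family n e F" "2 * real e \<le> \<epsilon> * n"
    "real (card F) \<le> 2 powr (2000 * ((1 / \<epsilon>) * log 2 (1 / \<epsilon>) * log 2 n))"
proof -
  define L where "L = log 2 (1 / \<epsilon>)"
  define l where "l = log 2 (real n)"
  define h where "h = nat \<lceil>L + 3\<rceil>"
  have l: "l \<ge> 1" using n by (simp add: l_def)
  have "(2::real) powr 4 < 1 / \<epsilon>" using eps by (simp add: field_simps)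
  then have L: "L \<ge> 4" unfolding L_def using eps by (subst le_log_iff) (auto simp: field_simps)
  have h: "L + 3 \<le> h" "h \<le> 2 * L" unfolding h_def using L by linarith+
  have h1: "h \<ge> 1" using h L by linarith
  define U where "U = (1 / \<epsilon>) * L * l"
  have "U \<ge> 0" unfolding U_def using eps L l by simp
  have U: "real h / \<epsilon> * l \<le> 2 * U"
  proof -
    have "real h / \<epsilon> * l \<le> (2 * L) / \<epsilon> * l"
      using h l eps by (intro mult_right_mono divide_right_mono) auto
    then show ?thesis by (simp add: U_def)
  qed
  show ?thesis
  proof (cases "\<epsilon> * n < 8 * real h")
    case True
    \<comment> \<open>The gap size would round down to 0 here, but \<open>n\<close> is then below
      \<open>8 * h / \<epsilon>\<close> and an exact list is short enough.\<close>
    obtain F where F: "approx_family n 0 F" "real (card F) \<le> 2 powr (3 * real n * log 2 n)"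
      using exact_family[OF n] .
    have "real n \<le> 8 * (real h / \<epsilon>)" using True eps by (simp add: field_simps)
    then have "3 * real n * l \<le> 3 * (8 * (real h / \<epsilon>)) * l" using l by (intro mult_right_mono mult_left_mono) auto
    also have "\<dots> = 24 * (real h / \<epsilon> * l)" by simp
    also have "\<dots> \<le> 2000 * U" using U \<open>U \<ge> 0\<close> by linarith
    finally have "2 powr (3 * real n * log 2 n) \<le> 2 powr (2000 * U)" unfolding l_def by simp
    then have "real (card F) \<le> 2 powr (2000 * U)" using F(2) by linarith
    then show ?thesis using eps unfolding U_def L_def l_def by (intro that[OF F(1)]) simp_all
  next
    case False
    \<comment> \<open>Half of the permitted error goes to the levels,
      \<open>4 * G * h \<le> \<epsilon> * n / 2\<close>, and half to the ends of the paths,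
      \<open>2 * t \<le> \<epsilon> * n / 2\<close>.\<close>
    define G where "G = nat \<lfloor>\<epsilon> * n / (8 * real h)\<rfloor>"
    define t where "t = nat \<lfloor>\<epsilon> * n / 4\<rfloor>"
    have big: "\<epsilon> * n / (8 * real h) \<ge> 1" "\<epsilon> * n \<ge> 8" using False h1 by (auto simp: field_simps)
    have G: "real G \<le> \<epsilon> * n / (8 * real h)" "\<epsilon> * n / (16 * real h) \<le> G" "G \<ge> 1"
      unfolding G_def using nat_floor_bounds[OF big(1)] by simp_all
    have "\<epsilon> * n / 4 \<ge> 1" using big(2) by simp
    then have t: "real t \<le> \<epsilon> * n / 4" "\<epsilon> * n / 8 \<le> t" "t \<ge> 1"
      unfolding t_def using nat_floor_bounds[of "\<epsilon> * n / 4"] by simp_all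
    have pow: "8 / \<epsilon> \<le> 2 ^ h"
    proof -
      have "8 / \<epsilon> = 2 powr (L + 3)" using eps by (simp add: L_def powr_add powr_minus divide_simps)
      also have "\<dots> \<le> 2 powr h" using h(1) by simp
      finally show ?thesis by (simp add: powr_realpow)
    qed
    have "real n = \<epsilon> * n / 8 * (8 / \<epsilon>)" using eps by simp
    also have "\<dots> \<le> real t * 2 ^ h" using t(2) pow eps by (intro mult_mono) auto
    finally have "real n \<le> real (t * 2 ^ h)" by simp
    then have nth: "n \<le> t * 2 ^ h" by (simp only: of_nat_le_iff)
    have "\<epsilon> * n / (8 * real h) \<le> n"
    proof -
      have "\<epsilon> * n \<le> 1 * real n" using eps by (intro mult_right_mono) auto
      also have "\<dots> \<le> real n * (8 * real h)" using h1 by (simp add: mult_le_cancel_left1)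
      finally show ?thesis using h1 by (simp add: field_simps)
    qed
    then have "G \<le> n" using G(1) by linarith
    obtain F where F: "approx_family n (t + 2 * G * h) F"
      "real (card F) \<le> 2 powr (18 * real n / real G * log 2 n + real h * n * (5 * log 2 n / t + 6 / G))"
      using sketch_family[OF n G(3) t(3) \<open>G \<le> n\<close> nth] .
    have err: "2 * real (t + 2 * G * h) \<le> \<epsilon> * n"
    proof -
      have "4 * real G * h \<le> \<epsilon> * n / 2" using G(1) h1 by (simp add: field_simps)
      then show ?thesis using t(1) by simp
    qed
    have nG: "real n / real G \<le> 16 * real h / \<epsilon>" using G(2,3) h1 eps by (simp add: field_simps)
    have nt: "real n / real t \<le> 8 / \<epsilon>" using t(2,3) eps by (simp add: field_simps)
    have Ll: "L \<le> l"
    proof -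
      have "1 / \<epsilon> \<le> n" using big(2) eps by (simp add: field_simps)
      then show ?thesis unfolding L_def l_def using eps n by (subst log_le_cancel_iff) auto
    qed
    have a: "18 * real n / real G * l \<le> 288 * (real h / \<epsilon> * l)"
      using mult_right_mono[OF nG, of "18 * l"] l by (simp add: algebra_simps)
    have b: "real h * n * (5 * l / t) \<le> 40 * (real h / \<epsilon> * l)"
      using mult_right_mono[OF nt, of "5 * real h * l"] l by (simp add: algebra_simps)
    have c: "real h * n * (6 / G) \<le> 192 * (real h / \<epsilon> * l)"
    proof -
      have "real h * n * (6 / G) \<le> 6 * real h * (16 * real h / \<epsilon>)"
        using mult_right_mono[OF nG, of "6 * real h"] by (simp add: algebra_simps)
      also have "\<dots> = 96 * (real h / \<epsilon>) * real h" by simp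
      also have "\<dots> \<le> 96 * (real h / \<epsilon>) * (2 * l)"
        using h(2) Ll eps by (intro mult_left_mono) auto
      finally show ?thesis by simp
    qed
    have "18 * real n / real G * l + real h * n * (5 * l / t + 6 / G) \<le> 288 * (real h / \<epsilon> * l) + (40 * (real h / \<epsilon> * l) + 192 * (real h / \<epsilon> * l))"
      unfolding distrib_left by (intro add_mono a b c)
    also have "\<dots> = 520 * (real h / \<epsilon> * l)" by simp
    also have "\<dots> \<le> 520 * (2 * U)" using U by (rule mult_left_mono) simp
    also have "\<dots> \<le> 2000 * U" using \<open>U \<ge> 0\<close> by simp
    finally have "2 powr (18 * real n / real G * log 2 n + real h * n * (5 * log 2 n / t + 6 / G)) \<le> 2 powr (2000 * U)"
      unfolding l_def by simp
    then have "real (card F) \<le> 2 powr (2000 * U)" using F(2) by linarith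
    then show ?thesis unfolding U_def L_def l_def by (rule that[OF F(1) err])
  qed
qed

theorem theorem1:
  shows "\<exists>C > (0::real). \<exists>\<epsilon>\<^sub>0 \<in> {0<..<(1::real)}.
    \<forall>n::nat. \<forall>\<epsilon>::real. n \<ge> 2 \<longrightarrow> \<epsilon> \<in> {0<..<\<epsilon>\<^sub>0} \<longrightarrow>
      (\<exists>(E :: (real \<times> real) set \<Rightarrow> bool list)
         (Q :: bool list \<Rightarrow> (real \<times> real) set \<Rightarrow> real).
         \<forall>P. P \<subseteq> grid n \<longrightarrow> card P = n \<longrightarrow>
           real (length (E P))
             \<le> C * (1 / \<epsilon>) * log 2 (1 / \<epsilon>) * log 2 (log 2 (1 / \<epsilon>)) * log 2 (real n) \<and>
           (\<forall>R. axis_parallel_rectangle R \<longrightarrow>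
              \<bar>Q (E P) R - real (card (P \<inter> R))\<bar> \<le> \<epsilon> * real n))"
proof (intro exI[of _ "2001::real"] conjI bexI[of _ "1/16::real"] allI impI)
  fix n :: nat and \<epsilon> :: real
  assume n: "n \<ge> 2" and "\<epsilon> \<in> {0<..<1/16}"
  then have eps: "0 < \<epsilon>" "\<epsilon> < 1/16" by auto
  define U where "U = (1 / \<epsilon>) * log 2 (1 / \<epsilon>) * log 2 n"
  have "(2::real) powr 4 < 1 / \<epsilon>" using eps by (simp add: field_simps)
  then have L: "log 2 (1 / \<epsilon>) \<ge> 4" using eps by (subst le_log_iff) (auto simp: field_simps)
  \<comment> \<open>The family already meets the bound without the iterated logarithm;
    \<open>\<epsilon> < 1/16\<close> makes that factor at least 1.\<close>
  then have LL: "log 2 (log 2 (1 / \<epsilon>)) \<ge> 1" by (subst le_log_iff) auto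
  have l: "log 2 n \<ge> 1" using n by simp
  have "2 \<le> 1 / \<epsilon>" using eps by (simp add: field_simps)
  then have "1 * 1 * 1 \<le> U" unfolding U_def using eps L l by (intro mult_mono) auto
  then have U: "U \<ge> 1" by simp
  obtain F e where F: "approx_family n e F" "2 * real e \<le> \<epsilon> * n" "real (card F) \<le> 2 powr (2000 * U)"
    using small_family[OF n eps] unfolding U_def .
  let ?A = "{P. P \<subseteq> grid n \<and> card P = n}"
  let ?good = "\<lambda>P f. \<forall>a b. f a b \<le> dom_count (shear n ` int_points P) a b \<and>
                 dom_count (shear n ` int_points P) a b \<le> f a b + e"
  have fin: "finite F" using F(1) by (simp add: approx_family_def)
  have ex: "\<exists>f \<in> F. ?good P f" if "P \<in> ?A" for P
    using F(1) sheared_int_points[of P n] that by (simp add: approx_family_def)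
  have "0 \<le> 2000 * U" using U by simp
  obtain E :: "(real \<times> real) set \<Rightarrow> bool list" and D where ED: "\<forall>P \<in> ?A. real (length (E P)) \<le> 2000 * U + 1 \<and> ?good P (D (E P))"
    using encode_family[where A = ?A and good = ?good, OF fin F(3) \<open>0 \<le> 2000 * U\<close> ex] .
  have size: "2000 * U + 1 \<le> 2001 * (1 / \<epsilon>) * log 2 (1 / \<epsilon>) * log 2 (log 2 (1 / \<epsilon>)) * log 2 (real n)"
  proof -
    \<comment> \<open>The bit lost by rounding up the code length is absorbed because
      \<open>U \<ge> 1\<close>.\<close>
    have "2000 * U + 1 \<le> 2001 * U" using U by simp
    also have "\<dots> \<le> 2001 * U * log 2 (log 2 (1 / \<epsilon>))"
      using mult_left_mono[OF LL, of "2001 * U"] U by simp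
    also have "\<dots> = 2001 * (1 / \<epsilon>) * log 2 (1 / \<epsilon>) * log 2 (log 2 (1 / \<epsilon>)) * log 2 (real n)"
      by (simp add: U_def)
    finally show ?thesis .
  qed
  show "\<exists>(E :: (real \<times> real) set \<Rightarrow> bool list) (Q :: bool list \<Rightarrow> (real \<times> real) set \<Rightarrow> real).
         \<forall>P. P \<subseteq> grid n \<longrightarrow> card P = n \<longrightarrow>
           real (length (E P))
             \<le> 2001 * (1 / \<epsilon>) * log 2 (1 / \<epsilon>) * log 2 (log 2 (1 / \<epsilon>)) * log 2 (real n) \<and>
           (\<forall>R. axis_parallel_rectangle R \<longrightarrow>
              \<bar>Q (E P) R - real (card (P \<inter> R))\<bar> \<le> \<epsilon> * real n)"
  \<comment> \<open>The query map sees only the string and the rectangle: \<open>D\<close> was fixed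
    before any \<open>P\<close>.\<close>
  proof (intro exI[of _ E] exI[of _ "\<lambda>s. rect_estimate n (D s)"] allI impI conjI)
    fix P assume P: "P \<subseteq> grid n" "card P = n"
    then have "P \<in> ?A" by simp
    note ED_P = bspec[OF ED this]
    show "real (length (E P))
        \<le> 2001 * (1 / \<epsilon>) * log 2 (1 / \<epsilon>) * log 2 (log 2 (1 / \<epsilon>)) * log 2 (real n)"
      using conjunct1[OF ED_P] size by (rule order_trans)
    fix R assume R: "axis_parallel_rectangle R"
    have "?good P (D (E P))" using ED_P by (rule conjunct2)
    then have "\<bar>rect_estimate n (D (E P)) R - real (card (P \<inter> R))\<bar> \<le> 2 * real e"
      by (intro rect_estimate_error[OF P(1) R]) blast
    then show "\<bar>rect_estimate n (D (E P)) R - real (card (P \<inter> R))\<bar> \<le> \<epsilon> * real n"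
      using F(2) by linarith
  qed
qed auto

end
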